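(* Let $\mathcal{H}$ be a complex Hilbert space with an orthonormal basis $\{e_{j,k}\colon j\in\mathcal{J},\,k\in\mathbb{N}_0\}$, where $\mathcal{J}\neq\emptyset$ is a countable set, and let $\{w_{j,k}\colon j\in\mathcal{J},\,k\in\mathbb{N}_0\}\subseteq[0,\infty)$ be a bounded set of weights. Let $B\in\mathcal{B}(\mathcal{H})$ be the weighted backward shift operator $$Be_{j,k}=\begin{cases}0 & \text{if } k=0,\\ w_{j,k-1}\,e_{j,k-1} & \text{if } k\geq 1.\end{cases}$$ Then $B$ is cyclic if and only if there is at most one zero weight, i.e. at most one pair $(j,k)\in\mathcal{J}\times\mathbb{N}_0$ with $w_{j,k}=0$.
   Context: $\mathbb{N}_0=\{0,1,2,\dots\}$; countable means finite or countably infinite. $\mathcal{B}(\mathcal{H})$ is the algebra of bounded linear operators on $\mathcal{H}$. An operator $T\in\mathcal{B}(\mathcal{H})$ is cyclic if there is a vector $h\in\mathcal{H}$ (a cyclic vector) such that the closed linear span of $\{T^nh\colon n\in\mathbb{N}_0\}$ is $\mathcal{H}$. *)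

theory Defs
  imports "HOL-Analysis.Analysis"
begin

class complex_vector = real_vector +
  fixes scaleC :: "complex \<Rightarrow> 'a \<Rightarrow> 'a"  (infixr "*\<^sub>C" 75)
  assumes scaleC_add_right: "a *\<^sub>C (x + y) = a *\<^sub>C x + a *\<^sub>C y"
    and scaleC_add_left: "(a + b) *\<^sub>C x = a *\<^sub>C x + b *\<^sub>C x"
    and scaleC_scaleC: "a *\<^sub>C (b *\<^sub>C x) = (a * b) *\<^sub>C x"
    and scaleC_one: "1 *\<^sub>C x = x"
    and scaleC_of_real: "of_real r *\<^sub>C x = r *\<^sub>R x"

global_interpretation complex_vector: vector_space "scaleC :: complex \<Rightarrow> 'a \<Rightarrow> 'a::complex_vector"
  by unfold_locales
    (rule scaleC_add_right scaleC_add_left scaleC_scaleC scaleC_one)+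

text \<open>
  Convention: the inner product is antilinear in its first and linear in its second argument.
  The topology comes from the class \<^class>\<open>real_normed_vector\<close>; by the last axiom its norm is
  the one induced by the inner product.
\<close>

class complex_inner = complex_vector + real_normed_vector +
  fixes cinner :: "'a \<Rightarrow> 'a \<Rightarrow> complex"
  assumes cinner_commute: "cinner x y = cnj (cinner y x)"
    and cinner_add_right: "cinner x (y + z) = cinner x y + cinner x z"
    and cinner_scaleC_right: "cinner x (a *\<^sub>C y) = a * cinner x y"
    and cinner_ge_zero: "0 \<le> Re (cinner x x)"
    and cinner_eq_zero_iff: "cinner x x = 0 \<longleftrightarrow> x = 0"
    and norm_eq_sqrt_cinner: "norm x = sqrt (Re (cinner x x))"

class chilbert_space = complex_inner + complete_space

definition bounded_clinear :: "('a::complex_inner \<Rightarrow> 'b::complex_inner) \<Rightarrow> bool" where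
  "bounded_clinear f \<longleftrightarrow>
     Vector_Spaces.linear scaleC scaleC f \<and> (\<exists>K. \<forall>x. norm (f x) \<le> norm x * K)"

definition orthonormal_basis :: "'i set \<Rightarrow> ('i \<Rightarrow> 'a::complex_inner) \<Rightarrow> bool" where
  "orthonormal_basis I e \<longleftrightarrow>
     (\<forall>p\<in>I. \<forall>q\<in>I. cinner (e p) (e q) = (if p = q then 1 else 0)) \<and>
     closure (complex_vector.span (e ` I)) = UNIV"

definition cyclic_vector :: "('a::complex_inner \<Rightarrow> 'a) \<Rightarrow> 'a \<Rightarrow> bool" where
  "cyclic_vector T h \<longleftrightarrow> closure (complex_vector.span (range (\<lambda>n. (T ^^ n) h))) = UNIV"

definition cyclic :: "('a::complex_inner \<Rightarrow> 'a) \<Rightarrow> bool" where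
  "cyclic T \<longleftrightarrow> (\<exists>h. cyclic_vector T h)"

end

theory Submission
  imports Defs
begin

text \<open>
  If \<open>B\<close> is cyclic, the orthogonal complement of its range is at most one-dimensional, while each
  zero weight \<open>w j k\<close> puts \<open>e j k\<close> into that complement.

  Conversely, let \<open>P\<close> consist of the indices \<open>(j, k)\<close> such that no weight \<open>w j t\<close> with \<open>t \<ge> k\<close>
  vanishes. As in the Hilden--Wallen argument, a lacunary series \<open>g\<close> of basis vectors with rapidly
  decreasing coefficients has multiples of \<open>(B ^^ n) g\<close>, with \<open>n\<close> arbitrarily large, that approach
  any prescribed \<open>e p\<close> with \<open>p \<in> P\<close>. The indices outside \<open>P\<close> form a single finite block
  \<open>(j, 0), \<dots>, (j, k)\<close> ending at the zero weight (or there are none); as \<open>B\<close> is nilpotent on the span of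
  this block, \<open>g + e j k\<close> is cyclic.
\<close>

\<comment> \<open>Elementary geometry of complex inner product spaces\<close>
subclass (in chilbert_space) banach ..

lemma cinner_zero_right [simp]: "cinner x 0 = (0::complex)" for x :: "'a::complex_inner"
  using cinner_add_right[of x 0 0] by simp

lemma cinner_diff_right: "cinner x (y - z) = cinner x y - cinner x z" for x :: "'a::complex_inner"
  using cinner_add_right[of x "y - z" z] by simp

lemma cinner_add_left: "cinner (x + y) z = cinner x z + cinner y z" for x :: "'a::complex_inner"
  by (metis cinner_add_right cinner_commute complex_cnj_add)

lemma cinner_scaleC_left: "cinner (a *\<^sub>C x) z = cnj a * cinner x z" for x :: "'a::complex_inner"
  by (metis cinner_scaleC_right cinner_commute complex_cnj_mult)

lemma cinner_self: "cinner x x = of_real ((norm x)\<^sup>2)" for x :: "'a::complex_inner"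
proof -
  have "cnj (cinner x x) = cinner x x"
    using cinner_commute[of x x] by simp
  then have "Im (cinner x x) = 0"
    by (simp add: complex_eq_iff)
  moreover have "(norm x)\<^sup>2 = Re (cinner x x)"
    using cinner_ge_zero[of x] by (simp add: norm_eq_sqrt_cinner[of x])
  ultimately show ?thesis
    by (simp add: complex_eq_iff)
qed

lemma norm_scaleC: "norm (a *\<^sub>C x) = cmod a * norm x" for x :: "'a::complex_inner"
proof -
  have "cinner (a *\<^sub>C x) (a *\<^sub>C x) = (a * cnj a) * cinner x x"
    by (simp add: cinner_scaleC_right cinner_scaleC_left)
  also have "a * cnj a = of_real ((cmod a)\<^sup>2)"
    by (rule complex_norm_square[symmetric])
  finally have "complex_of_real ((norm (a *\<^sub>C x))\<^sup>2) = of_real ((cmod a * norm x)\<^sup>2)"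
    by (simp add: cinner_self power_mult_distrib)
  then have "(norm (a *\<^sub>C x))\<^sup>2 = (cmod a * norm x)\<^sup>2"
    by (simp only: of_real_eq_iff)
  then show ?thesis
    by simp
qed

lemma bounded_linear_scaleC: "bounded_linear (\<lambda>x::'a::complex_inner. a *\<^sub>C x)"
proof (rule bounded_linear_intro[where K = "cmod a"])
  show "a *\<^sub>C (r *\<^sub>R x) = r *\<^sub>R (a *\<^sub>C x)" for r and x :: 'a
    by (simp add: scaleC_of_real[symmetric] mult.commute)
qed (simp_all add: scaleC_add_right norm_scaleC mult.commute)

text \<open>Pythagoras: subtracting the component along \<open>u\<close> leaves a remainder
  \<open>y\<close> orthogonal to \<open>u\<close>. The bound serves to make the coordinate
  functionals continuous.\<close>

lemma norm_cinner_unit_le: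
  fixes u x :: "'a::complex_inner"
  assumes "cinner u u = 1"
  shows "cmod (cinner u x) \<le> norm x"
proof -
  define c y where "c = cinner u x" and "y = x - c *\<^sub>C u"
  have uy: "cinner u y = 0"
    by (simp add: y_def c_def cinner_diff_right cinner_scaleC_right assms)
  then have yu: "cinner y u = 0"
    by (metis cinner_commute complex_cnj_zero)
  have "x = y + c *\<^sub>C u"
    by (simp add: y_def)
  then have "cinner x x = cinner y y + cnj c * c"
    by (simp add: cinner_add_right cinner_add_left cinner_scaleC_right cinner_scaleC_left uy yu assms)
  also have "cnj c * c = of_real ((cmod c)\<^sup>2)"
    using complex_norm_square[of c] by (simp add: mult.commute)
  finally have "complex_of_real ((norm x)\<^sup>2) = of_real ((norm y)\<^sup>2 + (cmod c)\<^sup>2)"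
    by (simp add: cinner_self)
  then have "(norm x)\<^sup>2 = (norm y)\<^sup>2 + (cmod c)\<^sup>2"
    by (simp only: of_real_eq_iff)
  then have "(cmod c)\<^sup>2 \<le> (norm x)\<^sup>2"
    by simp
  then show ?thesis
    by (simp add: c_def)
qed

lemma bounded_linear_cinner_unit:
  fixes u :: "'a::complex_inner"
  assumes "cinner u u = 1"
  shows "bounded_linear (cinner u)"
proof (rule bounded_linear_intro[where K = 1])
  show "cinner u (r *\<^sub>R x) = r *\<^sub>R cinner u x" for r x
    by (simp add: scaleC_of_real[symmetric] cinner_scaleC_right scaleR_conv_of_real)
qed (simp_all add: cinner_add_right norm_cinner_unit_le[OF assms])

section \<open>Bounded complex-linear maps and closed complex subspaces\<close>

lemma bounded_clinear_add: "bounded_clinear f \<Longrightarrow> f (x + y) = f x + f y"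
  by (simp add: bounded_clinear_def Vector_Spaces.linear_iff)

lemma bounded_clinear_scaleC: "bounded_clinear f \<Longrightarrow> f (a *\<^sub>C x) = a *\<^sub>C f x"
  by (simp add: bounded_clinear_def Vector_Spaces.linear_iff)

lemma bounded_clinear_imp_bounded_linear:
  assumes "bounded_clinear f"
  shows "bounded_linear f"
proof -
  obtain K where "\<And>x. norm (f x) \<le> norm x * K"
    using assms by (auto simp: bounded_clinear_def)
  then show ?thesis
    by (intro bounded_linear_intro[where K = K])
      (simp_all add: bounded_clinear_add[OF assms] bounded_clinear_scaleC[OF assms]
        scaleC_of_real[symmetric])
qed

lemma csubspace_closure:
  fixes S :: "'a::complex_inner set"
  assumes "complex_vector.subspace S"
  shows "complex_vector.subspace (closure S)"
  unfolding complex_vector.subspace_def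
proof (intro conjI ballI allI)
  show "0 \<in> closure S"
    using complex_vector.subspace_0[OF assms] closure_subset by blast
next
  fix x y assume "x \<in> closure S" "y \<in> closure S"
  then obtain f g where "\<And>n. f n \<in> S" "f \<longlonglongrightarrow> x" "\<And>n. g n \<in> S" "g \<longlonglongrightarrow> y"
    by (auto simp: closure_sequential)
  then show "x + y \<in> closure S"
    unfolding closure_sequential
    by (intro exI[of _ "\<lambda>n. f n + g n"])
      (auto intro: tendsto_add complex_vector.subspace_add[OF assms])
next
  fix c x assume "x \<in> closure S"
  then obtain f where "\<And>n. f n \<in> S" "f \<longlonglongrightarrow> x"
    by (auto simp: closure_sequential)
  then show "c *\<^sub>C x \<in> closure S"
    unfolding closure_sequential
    by (intro exI[of _ "\<lambda>n. c *\<^sub>C f n"])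
      (auto intro: bounded_linear.tendsto[OF bounded_linear_scaleC] complex_vector.subspace_scale[OF assms])
qed

text \<open>Weights and approximating coefficients are real, so the construction below runs over the
  reals; this lets the orbit closure, a complex subspace, absorb real multiples and real
  spans.\<close>

lemma csubspace_imp_subspace: "complex_vector.subspace S \<Longrightarrow> subspace S"
  unfolding complex_vector.subspace_def real_vector.subspace_def
  by (metis scaleC_of_real)

lemma csubspace_vanishing:
  assumes "\<And>x y. f (x + y) = f x + (f y :: complex)" and "\<And>a x. f (a *\<^sub>C x) = a * f x"
  shows "complex_vector.subspace {x. f x = 0}"
  using assms(2)[of 0 0] by (auto simp: complex_vector.subspace_def assms)

text \<open>The form in which density is used: \<open>M\<close> will be the zero set of a continuous
  functional, tested on a basis or an orbit, or an orbit closure, tested on the basis.\<close>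

lemma closed_csubspace_eq_UNIV:
  assumes "closure (complex_vector.span S) = UNIV"
    and "complex_vector.subspace M" and "closed M" and "S \<subseteq> M"
  shows "M = UNIV"
proof -
  have "complex_vector.span S \<subseteq> M"
    using assms by (intro complex_vector.span_minimal)
  then have "closure (complex_vector.span S) \<subseteq> M"
    using assms(3) by (rule closure_minimal)
  then show ?thesis
    using assms(1) by blast
qed

text \<open>For the invariance, the preimage of \<open>M\<close> under \<open>B\<close> is itself a
  closed complex subspace containing the orbit, hence contains \<open>M\<close>.\<close>

lemma closed_csubspace_orbit_closure:
  fixes B :: "'a::complex_inner \<Rightarrow> 'a" and h :: 'a
  defines "M \<equiv> closure (complex_vector.span (range (\<lambda>n. (B ^^ n) h)))"
  assumes B: "bounded_clinear B"
  shows "complex_vector.subspace M" and "closed M" and "\<And>n. (B ^^ n) h \<in> M"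
    and "\<And>x. x \<in> M \<Longrightarrow> B x \<in> M"
proof -
  let ?R = "range (\<lambda>n. (B ^^ n) h)"
  show sub: "complex_vector.subspace M" and cl: "closed M"
    by (simp_all add: M_def csubspace_closure)
  show orb: "(B ^^ n) h \<in> M" for n
    unfolding M_def using complex_vector.span_base[of "(B ^^ n) h" ?R] closure_subset by blast
  have blin: "bounded_linear B"
    by (rule bounded_clinear_imp_bounded_linear[OF B])
  have "?R \<subseteq> B -` M"
  proof safe
    fix n show "(B ^^ n) h \<in> B -` M"
      using orb[of "Suc n"] by simp
  qed
  moreover have "complex_vector.subspace (B -` M)"
    using sub linear_0[OF bounded_linear.linear[OF blin]]
    by (simp add: complex_vector.subspace_def bounded_clinear_add[OF B] bounded_clinear_scaleC[OF B])
  moreover have "closed (B -` M)"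
    using cl bounded_linear.continuous_on[OF blin continuous_on_id] by (rule closed_vimage)
  ultimately have "M \<subseteq> B -` M"
    unfolding M_def by (metis closure_minimal complex_vector.span_minimal)
  then show "B x \<in> M" if "x \<in> M" for x
    using that by blast
qed

section \<open>Powers of a weighted backward shift\<close>

lemma bounded_linear_funpow:
  fixes B :: "'a::real_normed_vector \<Rightarrow> 'a"
  assumes "bounded_linear B"
  shows "bounded_linear (B ^^ n)"
proof (induction n)
  case 0
  then show ?case by (simp add: bounded_linear_ident id_def)
next
  case (Suc n)
  then show ?case
    using bounded_linear_compose[OF assms Suc] by (simp add: o_def)
qed

lemma norm_funpow_le:
  fixes B :: "'a::real_normed_vector \<Rightarrow> 'a"
  assumes "\<And>x. norm (B x) \<le> norm x * K" and "0 \<le> K"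
  shows "norm ((B ^^ n) x) \<le> norm x * K ^ n"
proof (induction n)
  case (Suc n)
  have "norm ((B ^^ Suc n) x) \<le> norm ((B ^^ n) x) * K"
    using assms(1) by simp
  also have "\<dots> \<le> (norm x * K ^ n) * K"
    using Suc assms(2) by (rule mult_right_mono)
  finally show ?case by (simp add: mult_ac)
qed simp

lemma backward_shift_funpow:
  fixes B :: "'a::real_normed_vector \<Rightarrow> 'a" and v :: "nat \<Rightarrow> 'a"
  assumes "linear B" and "\<And>k. B (v (Suc k)) = w k *\<^sub>R v k"
  shows "(B ^^ n) (v (k + n)) = (\<Prod>t<n. w (k + t)) *\<^sub>R v k"
proof -
  have scale: "(B ^^ m) (r *\<^sub>R x) = r *\<^sub>R (B ^^ m) x" for m r x
    by (induction m) (simp_all add: linear_scale[OF assms(1)])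
  show ?thesis
  proof (induction n)
    case (Suc n)
    have "(B ^^ Suc n) (v (k + Suc n)) = (B ^^ n) (w (k + n) *\<^sub>R v (k + n))"
      by (simp add: funpow_swap1 assms(2) del: funpow.simps add: funpow_Suc_right)
    also have "\<dots> = w (k + n) *\<^sub>R (B ^^ n) (v (k + n))"
      by (rule scale)
    finally show ?case
      by (simp add: Suc mult.commute)
  qed simp
qed

text \<open>The first \<open>k\<close> applications lead to a multiple of \<open>v 0\<close>, and
  the next one kills it.\<close>

lemma backward_shift_funpow_eq_0:
  fixes B :: "'a::real_normed_vector \<Rightarrow> 'a" and v :: "nat \<Rightarrow> 'a"
  assumes "linear B" and "B (v 0) = 0" and "\<And>k. B (v (Suc k)) = w k *\<^sub>R v k" and "k < n"
  shows "(B ^^ n) (v k) = 0"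
proof -
  have zero: "(B ^^ m) 0 = 0" for m
    by (induction m) (simp_all add: linear_0[OF assms(1)])
  obtain m where n: "n = m + Suc k"
    using assms(4) by (metis add.commute less_iff_Suc_add add_Suc_right)
  have "(B ^^ Suc k) (v k) = 0"
    using backward_shift_funpow[of B v w, OF assms(1,3), of k 0]
    by (simp add: linear_scale[OF assms(1)] assms(2))
  then show ?thesis
    by (simp only: n funpow_add o_apply zero)
qed

section \<open>The lacunary vector\<close>

lemma geometric_tail_le:
  fixes c :: "nat \<Rightarrow> real"
  assumes "\<And>l. 0 < c l" and "\<And>l. c (Suc l) \<le> c l / 2"
  shows "summable c" and "(\<Sum>l. c (l + Suc i)) \<le> 2 * c (Suc i)"
proof -
  have le: "c (l + i) \<le> (1/2) ^ l * c i" for l i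
  proof (induction l)
    case (Suc l)
    then show ?case
      using assms(2)[of "l + i"] by simp
  qed simp
  have geo: "(\<lambda>l. (1/2) ^ l * c i) sums (2 * c i)" for i
    using sums_mult2[OF geometric_sums[of "1/2::real"], of "c i"] by simp
  show sm: "summable c"
  proof (rule summable_comparison_test'[OF sums_summable[OF geo[of 0]], of 0])
    show "norm (c l) \<le> (1/2) ^ l * c 0" for l
      using le[of l 0] assms(1)[of l] by simp
  qed
  have "(\<Sum>l. c (l + Suc i)) \<le> (\<Sum>l. (1/2) ^ l * c (Suc i))"
    by (rule suminf_le[OF le summable_ignore_initial_segment[OF sm] sums_summable[OF geo]])
  then show "(\<Sum>l. c (l + Suc i)) \<le> 2 * c (Suc i)"
    by (simp only: sums_unique[OF geo, symmetric])
qed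

text \<open>The vector is \<open>g = (\<Sum>l. c l *\<^sub>R f l)\<close>, where \<open>f l\<close>
  lies \<open>\<nu> l\<close> places above the target \<open>e (a l) (b l)\<close>. The power
  \<open>\<nu> i\<close> of \<open>B\<close> kills the terms with \<open>l < i\<close>, moves
  \<open>f i\<close> onto its target, and leaves the later terms negligible because \<open>c\<close>
  decays fast enough. Exponents beyond any \<open>m\<close> are demanded so that a nilpotent summand
  can be discarded later.\<close>

lemma backward_shift_approximating_vector:
  fixes B :: "'a::banach \<Rightarrow> 'a" and e :: "'j \<Rightarrow> nat \<Rightarrow> 'a"
  assumes B: "bounded_linear B"
    and B0: "\<And>j. j \<in> J \<Longrightarrow> B (e j 0) = 0"
    and BSuc: "\<And>j k. j \<in> J \<Longrightarrow> B (e j (Suc k)) = w j k *\<^sub>R e j k"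
    and norm_e: "\<And>j k. j \<in> J \<Longrightarrow> norm (e j k) = 1"
    and P: "countable P" "P \<noteq> {}" "fst ` P \<subseteq> J"
    and w_pos: "\<And>j k t. (j, k) \<in> P \<Longrightarrow> k \<le> t \<Longrightarrow> 0 < w j t"
    and P_up: "\<And>j k t. (j, k) \<in> P \<Longrightarrow> k \<le> t \<Longrightarrow> (j, t) \<in> P"
  obtains g where "g \<in> closure (span ((\<lambda>(j, k). e j k) ` P))"
    and "\<And>j k m \<epsilon>. (j, k) \<in> P \<Longrightarrow> 0 < \<epsilon> \<Longrightarrow> \<exists>n\<ge>m. \<exists>r::real. norm (r *\<^sub>R (B ^^ n) g - e j k) < \<epsilon>"
proof -
  obtain K0 where K0: "\<And>x. norm (B x) \<le> norm x * K0"
    using bounded_linear.bounded[OF B] by blast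
  \<comment> \<open>A bound of at least 1 keeps the powers of \<open>K\<close> positive, so that
    \<open>\<theta>\<close> may divide by them.\<close>
  define K where "K = max 1 K0"
  have K: "norm (B x) \<le> norm x * K" for x
    using K0[of x] mult_left_mono[of K0 K "norm x"] by (simp add: K_def)
  have K1: "1 \<le> K"
    by (simp add: K_def)
  have lin: "linear B"
    by (rule bounded_linear.linear[OF B])

  text \<open>An enumeration of \<open>P\<close> attaining every value infinitely often.\<close>
  define p where "p i = from_nat_into P (fst (prod_decode i))" for i
  define a b where "a i = fst (p i)" and "b i = snd (p i)" for i
  have pP: "(a i, b i) \<in> P" for i
    using from_nat_into[OF P(2)] by (simp add: a_def b_def p_def)
  have aJ: "a i \<in> J" for i
    using pP[of i] P(3) by force
  have recur: "\<exists>i\<ge>m. a i = j \<and> b i = k" if jk: "(j, k) \<in> P" for j k m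
  proof -
    obtain s where "from_nat_into P s = (j, k)"
      using from_nat_into_surj[OF P(1) jk] by blast
    then show ?thesis
      \<comment> \<open>The second component of the pair is free; taking it to be \<open>m\<close>
        pushes the code to at least \<open>m\<close>.\<close>
      by (intro exI[of _ "prod_encode (s, m)"]) (simp add: a_def b_def p_def le_prod_encode_2)
  qed

  \<comment> \<open>The increment exceeds \<open>b i\<close>, so \<open>\<nu> i\<close> is strictly
    larger than the position \<open>b l + \<nu> l\<close> of every earlier \<open>f l\<close>; this
    is what annihilates the earlier terms.\<close>
  define \<nu> where "\<nu> = rec_nat 0 (\<lambda>i n. n + b i + 1)"
  have \<nu>_Suc: "\<nu> (Suc i) = \<nu> i + b i + 1" for i
    by (simp add: \<nu>_def)
  have \<nu>_mono: "\<nu> i + (l - i) \<le> \<nu> l" if "i \<le> l" for i l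
    using that by (induction l rule: dec_induct) (auto simp: \<nu>_Suc)
  have \<nu>_ge: "i \<le> \<nu> i" for i
    using \<nu>_mono[of 0 i] by simp
  have \<nu>_gap: "b l + \<nu> l < \<nu> i" if "l < i" for l i
    using \<nu>_mono[of "Suc l" i] that by (simp add: \<nu>_Suc)

  \<comment> \<open>The factor picked up when the power \<open>\<nu> i\<close> of \<open>B\<close>
    carries \<open>f i\<close> to its target.\<close>
  define \<pi> where "\<pi> i = (\<Prod>t<\<nu> i. w (a i) (b i + t))" for i
  have \<pi>_pos: "0 < \<pi> i" for i
    unfolding \<pi>_def by (intro prod_pos ballI w_pos[OF pP]) simp
  \<comment> \<open>The quotient is tuned so that a tail of norm at most
    \<open>c i * \<theta> i\<close>, enlarged by \<open>K ^ \<nu> i\<close>, is at most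
    \<open>c i * \<pi> i / real (Suc i)\<close>. The cap 1 makes \<open>c\<close> at least halve at
    each step.\<close>
  define \<theta> where "\<theta> i = min 1 (\<pi> i / (real (Suc i) * K ^ \<nu> i))" for i
  have \<theta>: "0 < \<theta> i" "\<theta> i \<le> 1" for i
    using \<pi>_pos[of i] K1 by (auto simp: \<theta>_def)
  \<comment> \<open>The division by 2 cancels the factor 2 of the geometric tail bound.\<close>
  define c where "c = rec_nat 1 (\<lambda>i x. x * \<theta> i / 2)"
  have c_Suc: "c (Suc i) = c i * \<theta> i / 2" for i
    by (simp add: c_def)
  have c_pos: "0 < c i" for i
  proof (induction i)
    case 0
    show ?case by (simp add: c_def)
  next
    case (Suc i)
    then show ?case using \<theta> by (simp add: c_Suc)
  qed
  have c_half: "c (Suc i) \<le> c i / 2" for i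
    using mult_left_mono[OF \<theta>(2)[of i], of "c i"] c_pos[of i] by (simp add: c_Suc)
  have c_sum: "summable c"
    by (rule geometric_tail_le(1)[of c, OF c_pos c_half])
  have c_tail: "(\<Sum>l. c (l + Suc i)) \<le> c i * \<theta> i" for i
    using geometric_tail_le(2)[of c, OF c_pos c_half, of i] by (simp add: c_Suc)

  define f where "f l = e (a l) (b l + \<nu> l)" for l
  have norm_f: "norm (f l) = 1" for l
    by (simp add: f_def norm_e aJ)
  have norm_cf: "norm (c l *\<^sub>R f l) = c l" for l
    using c_pos[of l] by (simp add: norm_f)
  have f_sum: "summable (\<lambda>l. c l *\<^sub>R f l)"
    by (rule summable_norm_cancel) (simp only: norm_cf c_sum)
  define g where "g = (\<Sum>l. c l *\<^sub>R f l)"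

  have approx: "norm ((1 / (c i * \<pi> i)) *\<^sub>R (B ^^ \<nu> i) g - e (a i) (b i)) \<le> 1 / real (Suc i)" for i
  proof -
    let ?T = "B ^^ \<nu> i"
    have T: "bounded_linear ?T"
      by (rule bounded_linear_funpow[OF B])
    have before: "?T (f l) = 0" if "l < i" for l
      unfolding f_def
      by (rule backward_shift_funpow_eq_0[of B "e (a l)" "w (a l)", OF lin B0[OF aJ] BSuc[OF aJ] \<nu>_gap[OF that]])
    have at: "?T (f i) = \<pi> i *\<^sub>R e (a i) (b i)"
      unfolding f_def \<pi>_def by (rule backward_shift_funpow[of B "e (a i)" "w (a i)", OF lin BSuc[OF aJ]])
    let ?R = "\<Sum>l. c (l + Suc i) *\<^sub>R f (l + Suc i)"
    have "g = ?R + (\<Sum>l<Suc i. c l *\<^sub>R f l)"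
      unfolding g_def by (rule suminf_split_initial_segment[OF f_sum])
    then have "?T g = ?T ?R + (\<Sum>l<Suc i. c l *\<^sub>R ?T (f l))"
      by (simp add: linear_add linear_sum linear_scale bounded_linear.linear[OF T])
    also have "(\<Sum>l<Suc i. c l *\<^sub>R ?T (f l)) = (c i * \<pi> i) *\<^sub>R e (a i) (b i)"
      by (simp add: before at)
    finally have Tg: "?T g = ?T ?R + (c i * \<pi> i) *\<^sub>R e (a i) (b i)" .
    have "norm ?R \<le> (\<Sum>l. norm (c (l + Suc i) *\<^sub>R f (l + Suc i)))"
      unfolding norm_cf
      using summable_norm[of "\<lambda>l. c (l + Suc i) *\<^sub>R f (l + Suc i)"]
        summable_ignore_initial_segment[OF c_sum, of "Suc i"]
      by (simp only: norm_cf)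
    also have "\<dots> \<le> c i * \<theta> i"
      unfolding norm_cf by (rule c_tail)
    finally have R: "norm ?R \<le> c i * \<theta> i" .
    have "norm (?T ?R) \<le> norm ?R * K ^ \<nu> i"
      using K K1 by (intro norm_funpow_le) auto
    also have "\<dots> \<le> (c i * \<theta> i) * K ^ \<nu> i"
      using R K1 by (intro mult_right_mono) auto
    also have "\<dots> \<le> (c i * (\<pi> i / (real (Suc i) * K ^ \<nu> i))) * K ^ \<nu> i"
      using c_pos[of i] K1 by (intro mult_right_mono mult_left_mono) (auto simp: \<theta>_def)
    also have "\<dots> = (c i * \<pi> i) / real (Suc i)"
      using K1 by simp
    finally have TR: "norm (?T ?R) \<le> (c i * \<pi> i) / real (Suc i)" .
    have cp: "0 < c i * \<pi> i"
      using c_pos \<pi>_pos by simp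
    have "(1 / (c i * \<pi> i)) *\<^sub>R ?T g - e (a i) (b i) = (1 / (c i * \<pi> i)) *\<^sub>R ?T ?R"
      using c_pos[of i] \<pi>_pos[of i] unfolding Tg by (simp add: scaleR_add_right)
    then have "norm ((1 / (c i * \<pi> i)) *\<^sub>R ?T g - e (a i) (b i)) = norm (?T ?R) / (c i * \<pi> i)"
      using cp by simp
    also have "\<dots> \<le> ((c i * \<pi> i) / real (Suc i)) / (c i * \<pi> i)"
      using TR cp by (intro divide_right_mono) auto
    also have "\<dots> = 1 / real (Suc i)"
      using c_pos[of i] \<pi>_pos[of i] by simp
    finally show ?thesis .
  qed

  show thesis
  proof
    let ?S = "span ((\<lambda>(j, k). e j k) ` P)"
    have "f l \<in> ?S" for l
      unfolding f_def using P_up[OF pP, of l "b l + \<nu> l"] by (intro span_base) force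
    then have "(\<Sum>l<n. c l *\<^sub>R f l) \<in> ?S" for n
      by (intro span_sum span_scale)
    moreover have "(\<lambda>n. \<Sum>l<n. c l *\<^sub>R f l) \<longlonglongrightarrow> g"
      using f_sum unfolding g_def by (rule summable_LIMSEQ)
    ultimately show "g \<in> closure ?S"
      unfolding closure_sequential
      by (intro exI[of _ "\<lambda>n. \<Sum>l<n. c l *\<^sub>R f l"] conjI allI)
  next
    fix j k m and \<epsilon> :: real
    assume jk: "(j, k) \<in> P" and \<epsilon>: "0 < \<epsilon>"
    \<comment> \<open>The index \<open>i\<close> must be large twice over: beyond \<open>s\<close>
      for the accuracy, beyond \<open>m\<close> for the exponent.\<close>
    obtain s where s: "1 / real (Suc s) < \<epsilon>"
      using nat_approx_posE[OF \<epsilon>] .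
    obtain i where i: "max m s \<le> i" "a i = j" "b i = k"
      using recur[OF jk] by blast
    have "1 / real (Suc i) \<le> 1 / real (Suc s)"
      using i(1) by (intro divide_left_mono) auto
    then have "norm ((1 / (c i * \<pi> i)) *\<^sub>R (B ^^ \<nu> i) g - e j k) < \<epsilon>"
      using approx[of i] s i by simp
    moreover have "m \<le> \<nu> i"
      using i(1) \<nu>_ge[of i] by simp
    ultimately show "\<exists>n\<ge>m. \<exists>r. norm (r *\<^sub>R (B ^^ n) g - e j k) < \<epsilon>"
      by blast
  qed
qed

section \<open>The two implications\<close>

text \<open>A functional built from \<open>u\<close> and \<open>v\<close> vanishes on the range of
  \<open>B\<close>, so once it vanishes at the cyclic vector \<open>h\<close> it vanishes on the
  whole orbit and is zero by density. Yet two scalars \<open>cinner u h\<close> and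
  \<open>cinner v h\<close> always satisfy a nontrivial linear relation.\<close>

lemma cyclic_imp_left_kernel_le_one:
  fixes u v :: "'a::complex_inner"
  assumes "cyclic B"
    and uv: "cinner u u = 1" "cinner v v = 1" "cinner u v = 0" "cinner v u = 0"
    and Bu: "\<And>x. cinner u (B x) = 0" and Bv: "\<And>x. cinner v (B x) = 0"
  shows False
proof -
  obtain h where h: "closure (complex_vector.span (range (\<lambda>n. (B ^^ n) h))) = UNIV"
    using assms(1) by (auto simp: cyclic_def cyclic_vector_def)
  have key: "\<alpha> = 0 \<and> \<beta> = 0" if h0: "\<alpha> * cinner u h + \<beta> * cinner v h = 0" for \<alpha> \<beta>
  proof -
    define \<phi> where "\<phi> x = \<alpha> * cinner u x + \<beta> * cinner v x" for x
    have "{x. \<phi> x = 0} = UNIV"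
    proof (rule closed_csubspace_eq_UNIV[OF h])
      show "complex_vector.subspace {x. \<phi> x = 0}"
        by (rule csubspace_vanishing)
          (simp_all add: \<phi>_def cinner_add_right cinner_scaleC_right algebra_simps)
      show "closed {x. \<phi> x = 0}"
        unfolding \<phi>_def
        by (intro closed_Collect_eq continuous_intros
            bounded_linear.continuous_on[OF bounded_linear_cinner_unit] uv)
      show "range (\<lambda>n. (B ^^ n) h) \<subseteq> {x. \<phi> x = 0}"
      proof safe
        fix n show "\<phi> ((B ^^ n) h) = 0"
          using h0 by (cases n) (simp_all add: \<phi>_def Bu Bv)
      qed
    qed
    then have "\<phi> u = 0" "\<phi> v = 0"
      by blast+
    then show ?thesis
      by (simp add: \<phi>_def uv)
  qed
  \<comment> \<open>The relation with \<open>\<alpha> = cinner v h\<close> and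
    \<open>\<beta> = - cinner u h\<close> always holds, so both numbers vanish; then the
    coefficients 1 and 0 satisfy a relation too, which is absurd.\<close>
  have "cinner v h = 0 \<and> - cinner u h = 0"
    by (rule key) simp
  then have "(1::complex) = 0 \<and> (0::complex) = 0"
    by (intro key) simp
  then show False by simp
qed

theorem theorem5p1:
  fixes J :: "'j set"
    and e :: "'j \<Rightarrow> nat \<Rightarrow> 'a::chilbert_space"
    and w :: "'j \<Rightarrow> nat \<Rightarrow> real"
    and B :: "'a \<Rightarrow> 'a"
  assumes "J \<noteq> {}" and "countable J"
    and "orthonormal_basis (J \<times> UNIV) (\<lambda>(j, k). e j k)"
    and "\<And>j k. j \<in> J \<Longrightarrow> 0 \<le> w j k"
    and "bounded ((\<lambda>(j, k). w j k) ` (J \<times> UNIV))"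
    and "bounded_clinear B"
    and "\<And>j k. j \<in> J \<Longrightarrow>
           B (e j k) = (if k = 0 then 0 else of_real (w j (k - 1)) *\<^sub>C e j (k - 1))"
  shows "cyclic B \<longleftrightarrow> (\<exists>\<^sub>\<le>\<^sub>1p. fst p \<in> J \<and> w (fst p) (snd p) = 0)"
proof
  have on: "cinner (e j k) (e j' k') = (if j = j' \<and> k = k' then 1 else 0)"
    if "j \<in> J" "j' \<in> J" for j k j' k'
    using assms(3) that unfolding orthonormal_basis_def by fastforce
  have dense: "closure (complex_vector.span ((\<lambda>(j, k). e j k) ` (J \<times> UNIV))) = UNIV"
    using assms(3) by (simp add: orthonormal_basis_def)
  have blin: "bounded_linear B"
    by (rule bounded_clinear_imp_bounded_linear[OF assms(6)])
  have lin: "linear B"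
    by (rule bounded_linear.linear[OF blin])
  have B0: "B (e j 0) = 0" and BSuc: "B (e j (Suc k)) = w j k *\<^sub>R e j k" if "j \<in> J" for j k
    using assms(7)[OF that] by (simp_all add: scaleC_of_real)
  have norm_e: "norm (e j k) = 1" if "j \<in> J" for j k
    using that by (simp add: norm_eq_sqrt_cinner on)

  {
    assume cyc: "cyclic B"
    \<comment> \<open>Among basis vectors only \<open>e j (Suc k)\<close> could be mapped to a
      vector with a component along \<open>e j k\<close>, and its coefficient is the zero weight.
      Density extends this to all \<open>x\<close>.\<close>
    have left_kernel: "cinner (e j k) (B x) = 0" if jk: "j \<in> J" "w j k = 0" for j k x
    proof -
      have "{x. cinner (e j k) (B x) = 0} = UNIV"
      proof (rule closed_csubspace_eq_UNIV[OF dense])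
        show "complex_vector.subspace {x. cinner (e j k) (B x) = 0}"
          by (rule csubspace_vanishing)
            (simp_all add: bounded_clinear_add[OF assms(6)] bounded_clinear_scaleC[OF assms(6)]
              cinner_add_right cinner_scaleC_right)
        show "closed {x. cinner (e j k) (B x) = 0}"
          using jk(1)
          by (intro closed_Collect_eq continuous_on_const
              bounded_linear.continuous_on[OF bounded_linear_cinner_unit]
              bounded_linear.continuous_on[OF blin] continuous_on_id) (simp add: on)
        show "(\<lambda>(j, k). e j k) ` (J \<times> UNIV) \<subseteq> {x. cinner (e j k) (B x) = 0}"
          using jk by (auto simp: assms(7) cinner_scaleC_right on)
      qed
      then show ?thesis by blast
    qed
    show "\<exists>\<^sub>\<le>\<^sub>1p. fst p \<in> J \<and> w (fst p) (snd p) = 0"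
    proof (rule Uniq_I, rule ccontr)
      fix p q
      assume p: "fst p \<in> J \<and> w (fst p) (snd p) = 0" and q: "fst q \<in> J \<and> w (fst q) (snd q) = 0"
        and ne: "p \<noteq> q"
      show False
        by (rule cyclic_imp_left_kernel_le_one[OF cyc, of "e (fst p) (snd p)" "e (fst q) (snd q)"])
          (use p q ne in \<open>auto simp: on left_kernel prod_eq_iff\<close>)
    qed
  }

  assume uniq: "\<exists>\<^sub>\<le>\<^sub>1p. fst p \<in> J \<and> w (fst p) (snd p) = 0"
  have unique: "j = j' \<and> k = k'" if "j \<in> J" "w j k = 0" "j' \<in> J" "w j' k' = 0" for j k j' k'
    using Uniq_D[OF uniq, of "(j, k)" "(j', k')"] that by simp
  define P where "P = {(j, k). j \<in> J \<and> (\<forall>t\<ge>k. w j t \<noteq> 0)}"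
  have w_pos: "0 < w j t" if "(j, k) \<in> P" "k \<le> t" for j k t
    using that assms(4)[of j t] by (auto simp: P_def less_le)
  have P_ne: "P \<noteq> {}"
  proof -
    obtain j where j: "j \<in> J"
      using assms(1) by blast
    \<comment> \<open>Beyond its only possible zero weight, a row lies in \<open>P\<close>.\<close>
    show ?thesis
    proof (cases "\<exists>k. w j k = 0")
      case True
      then obtain k where "w j k = 0" by blast
      then have "(j, Suc k) \<in> P"
        using unique[OF j _ j] j by (fastforce simp: P_def)
      then show ?thesis by blast
    next
      case False
      then have "(j, 0) \<in> P"
        using j by (simp add: P_def)
      then show ?thesis by blast
    qed
  qed
  have P_J: "P \<subseteq> J \<times> UNIV"
    by (auto simp: P_def)
  have P_count: "countable P"
    using P_J assms(2) by (rule countable_subset[OF _ countable_SIGMA]) simp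
  have P_fst: "fst ` P \<subseteq> J"
    using P_J by auto
  have P_up: "(j, t) \<in> P" if "(j, k) \<in> P" "k \<le> t" for j k t
    using that by (auto simp: P_def)
  obtain g where g: "g \<in> closure (span ((\<lambda>(j, k). e j k) ` P))"
    and g_approx: "\<And>j k m \<epsilon>. (j, k) \<in> P \<Longrightarrow> 0 < \<epsilon> \<Longrightarrow>
      \<exists>n\<ge>m. \<exists>r. norm (r *\<^sub>R (B ^^ n) g - e j k) < \<epsilon>"
    by (rule backward_shift_approximating_vector[of B J e w P, OF blin B0 BSuc norm_e
          P_count P_ne P_fst w_pos P_up]) (assumption | rule that | blast)+

  \<comment> \<open>The vector \<open>u\<close> generates the finite block outside \<open>P\<close>:
    it is \<open>e j0 k0\<close> at the zero weight, and 0 if no weight vanishes, when there is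
    nothing to generate.\<close>
  obtain u m where u_nil: "\<And>n. m \<le> n \<Longrightarrow> (B ^^ n) u = 0"
    and u_gen: "\<And>j k. j \<in> J \<Longrightarrow> (j, k) \<notin> P \<Longrightarrow>
      \<exists>n r. e j k = (r::real) *\<^sub>R (B ^^ n) u"
  proof (cases "\<exists>j k. j \<in> J \<and> w j k = 0")
    case True
    then obtain j0 k0 where z: "j0 \<in> J" "w j0 k0 = 0" by blast
    show thesis
    proof
      show "(B ^^ n) (e j0 k0) = 0" if "Suc k0 \<le> n" for n
        using that by (intro backward_shift_funpow_eq_0[of B "e j0" "w j0", OF lin B0[OF z(1)] BSuc[OF z(1)]]) auto
    next
      fix j k assume "j \<in> J" "(j, k) \<notin> P"
      \<comment> \<open>Leaving \<open>P\<close> requires a zero weight at or beyond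
        \<open>k\<close> in row \<open>j\<close>, and the only one is at
        \<open>(j0, k0)\<close>.\<close>
      then have jk: "j = j0" "k \<le> k0"
        using unique[OF _ _ z] by (auto simp: P_def)
      let ?c = "\<Prod>t<k0 - k. w j0 (k + t)"
      \<comment> \<open>The path from \<open>k0\<close> down to \<open>k\<close> uses only weights
        strictly below \<open>k0\<close>, so it avoids the zero and can be inverted.\<close>
      have "w j0 t \<noteq> 0" if "t < k0" for t
        using unique[OF z(1) _ z, of t] that by auto
      then have "?c \<noteq> 0"
        using jk(2) by simp
      moreover have "(B ^^ (k0 - k)) (e j0 k0) = ?c *\<^sub>R e j0 k"
        using backward_shift_funpow[of B "e j0" "w j0", OF lin BSuc[OF z(1)], of "k0 - k" k] jk(2)
        by simp
      ultimately have "e j k = (1 / ?c) *\<^sub>R (B ^^ (k0 - k)) (e j0 k0)"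
        using jk(1) by simp
      then show "\<exists>n r. e j k = r *\<^sub>R (B ^^ n) (e j0 k0)"
        by blast
    qed
  next
    case False
    show thesis
    proof
      show "(B ^^ n) 0 = 0" for n
        using bounded_linear_funpow[OF blin] by (intro linear_0 bounded_linear.linear)
    qed (use False in \<open>auto simp: P_def\<close>)
  qed

  define M where "M = closure (complex_vector.span (range (\<lambda>n. (B ^^ n) (g + u))))"
  note M = closed_csubspace_orbit_closure[where h = "g + u", OF assms(6), folded M_def]
  have Msub: "subspace M"
    using M(1) by (rule csubspace_imp_subspace)
  \<comment> \<open>From the power \<open>m\<close> on, \<open>u\<close> has died out and the orbits
    of \<open>g + u\<close> and \<open>g\<close> agree.\<close>
  have orbit_large: "(B ^^ n) g \<in> M" if "m \<le> n" for n
    using M(3)[of n] u_nil[OF that] bounded_linear.linear[OF bounded_linear_funpow[OF blin]]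
    by (simp add: linear_add)
  have eP: "e j k \<in> M" if jk: "(j, k) \<in> P" for j k
  proof -
    have "\<exists>y\<in>M. dist y (e j k) < \<epsilon>" if "0 < \<epsilon>" for \<epsilon>
      using g_approx[OF jk that, of m] orbit_large subspace_scale[OF Msub] unfolding dist_norm by blast
    then have "e j k \<in> closure M"
      by (simp add: closure_approachable)
    then show ?thesis
      using M(2) by simp
  qed
  \<comment> \<open>This separates the two summands: \<open>g\<close> is a limit of combinations of
    vectors now known to lie in \<open>M\<close>, so \<open>u\<close> is the difference of two
    elements of \<open>M\<close>, and invariance brings in the rest of the block.\<close>
  have "span ((\<lambda>(j, k). e j k) ` P) \<subseteq> M"
    using eP by (intro span_minimal Msub) auto
  then have "g \<in> M"
    using g closure_minimal[OF _ M(2)] by blast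
  then have "u \<in> M"
    using subspace_diff[OF Msub M(3)[of 0], of g] by simp
  then have "(B ^^ n) u \<in> M" for n
    by (induction n) (simp_all add: M(4))
  then have "e j k \<in> M" if "j \<in> J" for j k
    using eP u_gen[OF that, of k] subspace_scale[OF Msub] by metis
  then have "M = UNIV"
    by (intro closed_csubspace_eq_UNIV[OF dense M(1,2)]) auto
  then show "cyclic B"
    unfolding cyclic_def cyclic_vector_def M_def by blast
qed

end
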